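(* Let $C$ be a conjugation on $L^2(\mathbb{T})$ such that $CM_{z^2}=M_{\bar z^2}C$. Then $C=M_{[\psi_1,\psi_2]}J$ for some $\psi_1,\psi_2\in L^\infty(\mathbb{T})$ with $\psi_1^o=\psi_2^o$ and $|\psi_1|^2+|\psi_2|^2=2$ a.e. on $\mathbb{T}$. Conversely, any conjugation $C$ on $L^2(\mathbb{T})$ of the form $C=M_{[\psi_1,\psi_2]}J$ with $\psi_1,\psi_2\in L^\infty(\mathbb{T})$ satisfies $CM_{z^2}=M_{\bar z^2}C$.
   Context: $\mathbb{T}$ is the unit circle with normalized Lebesgue measure. A conjugation on a Hilbert space $\mathcal{H}$ is an antilinear map $C:\mathcal{H}\to\mathcal{H}$ with $C^2=I$ and $\langle Cf,Cg\rangle=\langle g,f\rangle$ for all $f,g$. For $\phi\in L^\infty(\mathbb{T})$, $M_\phi f=\phi f$ on $L^2(\mathbb{T})$. For $f\in L^2(\mathbb{T})$, $f^e(z)=\frac{f(z)+f(-z)}{2}$ and $f^o(z)=\frac{f(z)-f(-z)}{2}$ are the even and odd parts, so $f=f^e+f^o$. For $\phi_1,\phi_2\in L^\infty(\mathbb{T})$, $M_{[\phi_1,\phi_2]}$ is the bounded linear operator on $L^2(\mathbb{T})$ given by $M_{[\phi_1,\phi_2]}f=\phi_1f^e+\phi_2f^o$. The conjugation $J$ on $L^2(\mathbb{T})$ is $Jf=\overline{f}$. *)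

theory Defs
  imports "HOL-Analysis.Analysis"
begin

section \<open>The unit circle with normalized Lebesgue measure\<close>

definition circ :: "complex measure" where
  "circ = distr (uniform_measure lborel {0..<2*pi}) (restrict_space borel (sphere 0 1)) cis"

lemma space_circ [simp]: "space circ = sphere 0 1"
  by (simp add: circ_def space_restrict_space)

lemma sets_circ [measurable_cong]: "sets circ = sets (restrict_space borel (sphere 0 1))"
  by (simp add: circ_def)

lemma cis_measurable_circ [measurable]:
  "cis \<in> measurable borel (restrict_space borel (sphere 0 1))"
  by (rule measurable_restrict_space2)
     (auto intro!: borel_measurable_continuous_onI continuous_intros)

lemma cnj_borel_measurable [measurable (raw)]:
  assumes "f \<in> borel_measurable M"
  shows "(\<lambda>x. cnj (f x)) \<in> borel_measurable M"
proof -
  have "cnj \<in> borel_measurable borel"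
    by (intro borel_measurable_continuous_onI continuous_intros)
  from measurable_compose[OF assms this] show ?thesis .
qed

lemma uminus_measurable_circ [measurable]: "uminus \<in> measurable circ circ"
proof -
  have "uminus \<in> measurable (restrict_space borel (sphere 0 1))
          (restrict_space borel (sphere (0::complex) 1))"
    by (rule measurable_restrict_space2)
       (auto simp: space_restrict_space intro!: measurable_restrict_space1)
  thus ?thesis
    by (simp add: measurable_cong_sets[OF sets_circ sets_circ])
qed

lemma emeasure_circ:
  assumes A: "A \<in> sets circ"
  shows "emeasure circ A = emeasure lborel ({0..<2*pi} \<inter> cis -` A) / ennreal (2*pi)"
proof -
  have B: "cis -` A \<in> sets borel"
    using measurable_sets[OF cis_measurable_circ, of A] A by (simp add: sets_circ)
  have "emeasure circ A = emeasure (uniform_measure lborel {0..<2*pi}) (cis -` A)"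
    unfolding circ_def using A
    by (subst emeasure_distr) (simp_all add: sets_circ)
  also have "\<dots> = emeasure lborel ({0..<2*pi} \<inter> cis -` A) / ennreal (2*pi)"
    using B by (subst emeasure_uniform_measure) auto
  finally show ?thesis .
qed

lemma emeasure_circ_space: "emeasure circ (sphere 0 1) = 1"
proof -
  have "cis -` sphere 0 1 = UNIV" by auto
  thus ?thesis
    using emeasure_circ[OF sets.top[of circ]] by (simp add: ennreal_divide_self)
qed

interpretation circ: finite_measure circ
  by (rule finite_measureI) (simp add: emeasure_circ_space)

lemma circ_uminus_invariant: "distr circ circ uminus = circ"
proof (rule measure_eqI)
  fix A assume "A \<in> sets (distr circ circ uminus)"
  hence A: "A \<in> sets circ" by simp
  have mA: "uminus -` A \<inter> space circ \<in> sets circ"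
    by (rule measurable_sets[OF uminus_measurable_circ A])
  define S where "S = cis -` A"
  define T where "T = (\<lambda>t. pi + t) -` S"
  have S [measurable]: "S \<in> sets borel"
    using measurable_sets[OF cis_measurable_circ, of A] A by (simp add: sets_circ S_def)
  have T [measurable]: "T \<in> sets borel"
    using measurable_sets[of "\<lambda>t. pi + t" borel borel S] S by (simp add: T_def)
  have T_eq: "cis -` (uminus -` A \<inter> space circ) = T"
    by (auto simp: T_def S_def cis_mult[symmetric])
  have per: "pi + t \<in> T \<longleftrightarrow> t \<in> S" for t
    by (simp add: T_def S_def flip: cis_mult)
  have shift: "emeasure lborel B = emeasure lborel ((\<lambda>t. pi + t) -` B)" if "B \<in> sets borel" for B
  proof -
    have "emeasure lborel B = emeasure (distr lborel borel ((+) pi)) B"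
      by (simp add: lborel_distr_plus)
    thus ?thesis using that by (subst (asm) emeasure_distr) auto
  qed
  have split: "emeasure lborel ({0..<2*pi} \<inter> U)
      = emeasure lborel ({0..<pi} \<inter> U) + emeasure lborel ({pi..<2*pi} \<inter> U)"
    if [measurable]: "U \<in> sets borel" for U
    by (subst plus_emeasure) (auto intro!: arg_cong[where f = "emeasure lborel"])
  have 1: "emeasure lborel ({pi..<2*pi} \<inter> S) = emeasure lborel ({0..<pi} \<inter> T)"
    by (subst shift) (auto intro!: arg_cong[where f = "emeasure lborel"] simp: T_def)
  have 2: "emeasure lborel ({pi..<2*pi} \<inter> T) = emeasure lborel ({0..<pi} \<inter> S)"
    by (subst shift) (auto intro!: arg_cong[where f = "emeasure lborel"] simp: per)
  have "emeasure (distr circ circ uminus) A = emeasure circ (uminus -` A \<inter> space circ)"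
    using A by (subst emeasure_distr) auto
  also have "\<dots> = emeasure lborel ({0..<2*pi} \<inter> T) / ennreal (2*pi)"
    by (simp only: emeasure_circ[OF mA] T_eq)
  also have "emeasure lborel ({0..<2*pi} \<inter> T) = emeasure lborel ({0..<2*pi} \<inter> S)"
    by (simp add: split 1 2 add.commute)
  also have "\<dots> / ennreal (2*pi) = emeasure circ A"
    by (simp add: emeasure_circ[OF A] S_def)
  finally show "emeasure (distr circ circ uminus) A = emeasure circ A" .
qed simp

lemma AE_circ_uminus:
  assumes "AE z in circ. P z"
  shows "AE z in circ. P (- z)"
proof -
  have "AE z in distr circ circ uminus. P z"
    unfolding circ_uminus_invariant by (rule assms)
  thus ?thesis by (rule AE_distrD[OF uminus_measurable_circ])
qed

section \<open>Even and odd parts of functions\<close>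

definition even_part :: "(complex \<Rightarrow> complex) \<Rightarrow> complex \<Rightarrow> complex" where
  "even_part f z = (f z + f (- z)) / 2"

definition odd_part :: "(complex \<Rightarrow> complex) \<Rightarrow> complex \<Rightarrow> complex" where
  "odd_part f z = (f z - f (- z)) / 2"

section \<open>Representatives: square-integrable and essentially bounded functions\<close>

definition sq_integrable :: "(complex \<Rightarrow> complex) set" where
  "sq_integrable = {f \<in> borel_measurable circ. integrable circ (\<lambda>z. (cmod (f z))\<^sup>2)}"

definition Linfty :: "(complex \<Rightarrow> complex) set" where
  "Linfty = {\<phi> \<in> borel_measurable circ. \<exists>B. AE z in circ. cmod (\<phi> z) \<le> B}"

lemma sq_integrable_0: "(\<lambda>z. 0) \<in> sq_integrable"
  by (simp add: sq_integrable_def)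

lemma sq_integrable_add:
  assumes "f \<in> sq_integrable" "g \<in> sq_integrable"
  shows "(\<lambda>z. f z + g z) \<in> sq_integrable"
proof -
  have [measurable]: "f \<in> borel_measurable circ" "g \<in> borel_measurable circ"
    using assms by (auto simp: sq_integrable_def)
  have "integrable circ (\<lambda>z. 2 * (cmod (f z))\<^sup>2 + 2 * (cmod (g z))\<^sup>2)"
    using assms by (auto simp: sq_integrable_def)
  hence "integrable circ (\<lambda>z. (cmod (f z + g z))\<^sup>2)"
  proof (rule Bochner_Integration.integrable_bound)
    have "(cmod (a + b))\<^sup>2 \<le> 2 * (cmod a)\<^sup>2 + 2 * (cmod b)\<^sup>2" for a b
    proof -
      have "(cmod (a + b))\<^sup>2 \<le> (cmod a + cmod b)\<^sup>2"
        by (intro power_mono norm_triangle_ineq) simp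
      thus ?thesis
        using sum_squares_bound[of "cmod a" "cmod b"] by (simp add: power2_sum)
    qed
    thus "AE z in circ. norm ((cmod (f z + g z))\<^sup>2)
            \<le> norm (2 * (cmod (f z))\<^sup>2 + 2 * (cmod (g z))\<^sup>2)"
      by (intro AE_I2) (simp add: abs_of_nonneg)
  qed simp
  thus ?thesis by (simp add: sq_integrable_def)
qed

lemma Linfty_mult_sq_integrable:
  assumes "\<phi> \<in> Linfty" "f \<in> sq_integrable"
  shows "(\<lambda>z. \<phi> z * f z) \<in> sq_integrable"
proof -
  have [measurable]: "\<phi> \<in> borel_measurable circ" "f \<in> borel_measurable circ"
    using assms by (auto simp: sq_integrable_def Linfty_def)
  obtain B where B: "AE z in circ. cmod (\<phi> z) \<le> B"
    using assms by (auto simp: Linfty_def)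
  have "integrable circ (\<lambda>z. B\<^sup>2 * (cmod (f z))\<^sup>2)"
    using assms by (auto simp: sq_integrable_def)
  hence "integrable circ (\<lambda>z. (cmod (\<phi> z * f z))\<^sup>2)"
  proof (rule Bochner_Integration.integrable_bound)
    show "AE z in circ. norm ((cmod (\<phi> z * f z))\<^sup>2) \<le> norm (B\<^sup>2 * (cmod (f z))\<^sup>2)"
      using B
      by eventually_elim
         (auto simp: norm_mult power_mult_distrib intro!: mult_right_mono power_mono)
  qed simp
  thus ?thesis by (simp add: sq_integrable_def)
qed

lemma Linfty_const: "(\<lambda>z. c) \<in> Linfty"
  by (auto simp: Linfty_def)

lemma sq_integrable_scale:
  assumes "f \<in> sq_integrable"
  shows "(\<lambda>z. c * f z) \<in> sq_integrable"
  using Linfty_mult_sq_integrable[OF Linfty_const assms] .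

lemma sq_integrable_uminus_arg:
  assumes "f \<in> sq_integrable"
  shows "(\<lambda>z. f (- z)) \<in> sq_integrable"
proof -
  have f [measurable]: "f \<in> borel_measurable circ"
    using assms by (auto simp: sq_integrable_def)
  have "integrable (distr circ circ uminus) (\<lambda>z. (cmod (f z))\<^sup>2)"
    using assms by (simp add: sq_integrable_def circ_uminus_invariant)
  hence "integrable circ (\<lambda>z. (cmod (f (- z)))\<^sup>2)"
    by (subst (asm) integrable_distr_eq) auto
  thus ?thesis by (auto simp: sq_integrable_def)
qed

lemma sq_integrable_even_part:
  assumes "f \<in> sq_integrable"
  shows "even_part f \<in> sq_integrable"
proof -
  have "even_part f = (\<lambda>z. (1/2) * (f z + f (- z)))"
    by (simp add: even_part_def fun_eq_iff)
  thus ?thesis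
    using assms by (auto intro!: sq_integrable_scale sq_integrable_add sq_integrable_uminus_arg
        simp del: times_divide_eq_left)
qed

lemma sq_integrable_odd_part:
  assumes "f \<in> sq_integrable"
  shows "odd_part f \<in> sq_integrable"
proof -
  have "odd_part f = (\<lambda>z. (1/2) * (f z + (-1) * f (- z)))"
    by (simp add: odd_part_def fun_eq_iff)
  thus ?thesis
    using assms
    by (metis (no_types) sq_integrable_scale sq_integrable_add sq_integrable_uminus_arg)
qed

lemma sq_integrable_cnj:
  assumes "f \<in> sq_integrable"
  shows "(\<lambda>z. cnj (f z)) \<in> sq_integrable"
  using assms by (auto simp: sq_integrable_def)

section \<open>The space \<open>L\<^sup>2\<close> of the circle\<close>

definition L2rel :: "(complex \<Rightarrow> complex) \<Rightarrow> (complex \<Rightarrow> complex) \<Rightarrow> bool" where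
  "L2rel f g \<longleftrightarrow> f \<in> sq_integrable \<and> g \<in> sq_integrable \<and> (AE z in circ. f z = g z)"

quotient_type L2T = "complex \<Rightarrow> complex" / partial: L2rel
proof (rule part_equivpI)
  show "\<exists>f. L2rel f f"
    using sq_integrable_0 by (auto simp: L2rel_def)
  show "symp L2rel"
    by (auto simp: symp_def L2rel_def eq_commute)
  show "transp L2rel"
  proof (rule transpI)
    fix f g h assume "L2rel f g" "L2rel g h"
    moreover from this have "AE z in circ. f z = h z"
      unfolding L2rel_def by auto
    ultimately show "L2rel f h" by (auto simp: L2rel_def)
  qed
qed

instantiation L2T :: ab_group_add
begin

lift_definition zero_L2T :: L2T is "\<lambda>z. 0"
  by (simp add: L2rel_def sq_integrable_0)

lift_definition plus_L2T :: "L2T \<Rightarrow> L2T \<Rightarrow> L2T" is "\<lambda>f g z. f z + g z"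
  unfolding L2rel_def by (auto intro: sq_integrable_add)

lift_definition uminus_L2T :: "L2T \<Rightarrow> L2T" is "\<lambda>f z. - f z"
  unfolding L2rel_def using sq_integrable_scale[of _ "- 1"] by auto

definition minus_L2T :: "L2T \<Rightarrow> L2T \<Rightarrow> L2T" where
  "minus_L2T F G = F + (- G)"

instance
proof
  fix a b c :: L2T
  show "a + b + c = a + (b + c)"
    by transfer (auto simp: L2rel_def add.assoc intro: sq_integrable_add)
  show "a + b = b + a"
    by transfer (auto simp: L2rel_def add.commute intro: sq_integrable_add)
  show "0 + a = a"
    by transfer (auto simp: L2rel_def)
  show "- a + a = 0"
    by transfer (auto simp: L2rel_def sq_integrable_0)
  show "a - b = a + - b"
    by (rule minus_L2T_def)
qed

end

lift_definition scaleC_L2T :: "complex \<Rightarrow> L2T \<Rightarrow> L2T" is "\<lambda>c f z. c * f z"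
  unfolding L2rel_def by (auto intro: sq_integrable_scale)

lift_definition inner_L2T :: "L2T \<Rightarrow> L2T \<Rightarrow> complex" is "\<lambda>f g. LINT z|circ. f z * cnj (g z)"
proof -
  fix f f' g g' :: "complex \<Rightarrow> complex"
  assume a: "L2rel f f'" "L2rel g g'"
  hence [measurable]: "f \<in> borel_measurable circ" "f' \<in> borel_measurable circ"
      "g \<in> borel_measurable circ" "g' \<in> borel_measurable circ"
    by (auto simp: L2rel_def sq_integrable_def)
  have "AE z in circ. f z = f' z" "AE z in circ. g z = g' z"
    using a by (auto simp: L2rel_def)
  hence "AE z in circ. f z * cnj (g z) = f' z * cnj (g' z)"
    by eventually_elim simp
  thus "(LINT z|circ. f z * cnj (g z)) = (LINT z|circ. f' z * cnj (g' z))"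
    by (intro integral_cong_AE) auto
qed

definition conjugation :: "(L2T \<Rightarrow> L2T) \<Rightarrow> bool" where
  "conjugation C \<longleftrightarrow>
     (\<forall>f g. C (f + g) = C f + C g) \<and>
     (\<forall>c f. C (scaleC_L2T c f) = scaleC_L2T (cnj c) (C f)) \<and>
     (\<forall>f. C (C f) = f) \<and>
     (\<forall>f g. inner_L2T (C f) (C g) = inner_L2T g f)"

section \<open>Operators\<close>

lift_definition even_L2T :: "L2T \<Rightarrow> L2T" is even_part
  unfolding L2rel_def
proof (elim conjE, intro conjI sq_integrable_even_part)
  fix f g :: "complex \<Rightarrow> complex" assume "AE z in circ. f z = g z"
  from this AE_circ_uminus[OF this] show "AE z in circ. even_part f z = even_part g z"
    by eventually_elim (simp add: even_part_def)
qed

lift_definition odd_L2T :: "L2T \<Rightarrow> L2T" is odd_part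
  unfolding L2rel_def
proof (elim conjE, intro conjI sq_integrable_odd_part)
  fix f g :: "complex \<Rightarrow> complex" assume "AE z in circ. f z = g z"
  from this AE_circ_uminus[OF this] show "AE z in circ. odd_part f z = odd_part g z"
    by eventually_elim (simp add: odd_part_def)
qed

text \<open>Only meaningful for a symbol in \<^const>\<open>Linfty\<close>; the value \<open>0\<close> for any other symbol is junk.\<close>

lift_definition mult_op :: "(complex \<Rightarrow> complex) \<Rightarrow> L2T \<Rightarrow> L2T"
  is "\<lambda>\<phi> f. if \<phi> \<in> Linfty then (\<lambda>z. \<phi> z * f z) else (\<lambda>z. 0)"
  unfolding L2rel_def by (auto intro: Linfty_mult_sq_integrable sq_integrable_0)

definition mult_op2 :: "(complex \<Rightarrow> complex) \<Rightarrow> (complex \<Rightarrow> complex) \<Rightarrow> L2T \<Rightarrow> L2T" where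
  "mult_op2 \<phi>\<^sub>1 \<phi>\<^sub>2 f = mult_op \<phi>\<^sub>1 (even_L2T f) + mult_op \<phi>\<^sub>2 (odd_L2T f)"

lift_definition J :: "L2T \<Rightarrow> L2T" is "\<lambda>f z. cnj (f z)"
  unfolding L2rel_def by (auto intro: sq_integrable_cnj)

section \<open>Sanity checks\<close>

lemma even_add_odd_L2T: "even_L2T f + odd_L2T f = f"
  by transfer (auto simp: L2rel_def even_part_def odd_part_def field_simps)

lemma conjugation_J: "conjugation J"
  unfolding conjugation_def
proof (intro conjI allI)
  fix f g :: L2T and c :: complex
  show "J (f + g) = J f + J g"
    by transfer (auto simp: L2rel_def intro!: sq_integrable_add sq_integrable_cnj)
  show "J (scaleC_L2T c f) = scaleC_L2T (cnj c) (J f)"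
    by transfer (auto simp: L2rel_def intro!: sq_integrable_scale sq_integrable_cnj)
  show "J (J f) = f"
    by transfer (auto simp: L2rel_def)
  show "inner_L2T (J f) (J g) = inner_L2T g f"
    by transfer (simp add: mult.commute)
qed

lemma Linfty_power2: "(\<lambda>z. z\<^sup>2) \<in> Linfty" "(\<lambda>z. (cnj z)\<^sup>2) \<in> Linfty"
proof -
  have id [measurable]: "(\<lambda>z. z) \<in> borel_measurable circ"
    by (simp add: measurable_cong_sets[OF sets_circ refl] measurable_restrict_space1)
  show "(\<lambda>z. z\<^sup>2) \<in> Linfty" "(\<lambda>z. (cnj z)\<^sup>2) \<in> Linfty"
    by (auto simp: Linfty_def norm_power intro!: exI[of _ 1] AE_I2)
qed

lemma inner_L2T_definite: "inner_L2T f f = 0 \<longleftrightarrow> f = 0"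
proof transfer
  fix f :: "complex \<Rightarrow> complex" assume "L2rel f f"
  hence f: "f \<in> sq_integrable" by (simp add: L2rel_def)
  have "(LINT z|circ. f z * cnj (f z)) = (LINT z|circ. complex_of_real ((cmod (f z))\<^sup>2))"
    by (simp only: complex_norm_square)
  also have "\<dots> = complex_of_real (LINT z|circ. (cmod (f z))\<^sup>2)"
    by (rule integral_complex_of_real)
  also have "\<dots> = 0 \<longleftrightarrow> (AE z in circ. f z = 0)"
    using f by (simp add: sq_integrable_def integral_nonneg_eq_0_iff_AE)
  finally show "(LINT z|circ. f z * cnj (f z)) = 0 \<longleftrightarrow> L2rel f (\<lambda>z. 0)"
    using f by (simp add: L2rel_def sq_integrable_0)
qed

end

theory Submission
  imports Defs
begin

text \<open>
  An integrable function on the circle that is orthogonal to all powers \<open>z\<^sup>2\<^sup>n\<close> has vanishing even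
  part. Since \<open>C\<close> intertwines multiplication by \<open>z\<^sup>2\<^sup>n\<close> and by its conjugate, the scalar identity
  \<open>\<langle>C f, g\<rangle> = \<langle>C g, f\<rangle>\<close> therefore localizes to an identity between the even parts of \<open>C f \<cdot> cnj g\<close>
  and \<open>C g \<cdot> cnj f\<close>. Put \<open>\<psi>\<^sub>1 = C 1\<close> and \<open>\<psi>\<^sub>2 = cnj z \<cdot> C (cnj z)\<close>. Taking \<open>g = 1\<close> and \<open>g = cnj z\<close>
  determines the even and the odd part of \<open>C f\<close> pointwise, with no density argument and no
  boundedness known beforehand; the pair \<open>(1, cnj z)\<close> gives equality of the odd parts of \<open>\<psi>\<^sub>1\<close> and
  \<open>\<psi>\<^sub>2\<close>. Replacing \<open>g\<close> by \<open>C g\<close> gives orthogonality relations saying that a 2-by-2 matrix is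
  unitary, whence the bounds and the norm identity.
\<close>

section \<open>Uniqueness of Fourier coefficients\<close>

lemma borel_measurable_circ_continuous_on:
  fixes f :: "complex \<Rightarrow> 'b::topological_space"
  assumes "continuous_on (sphere 0 1) f"
  shows "f \<in> borel_measurable circ"
  using borel_measurable_continuous_on_restrict[OF assms]
  by (simp add: measurable_cong_sets[OF sets_circ refl])

lemma AE_circ_sphere: "AE z in circ. cmod z = 1"
  by (rule AE_I2) simp

lemma integrable_circ_mult_continuous_on:
  fixes p k :: "complex \<Rightarrow> complex"
  assumes "continuous_on (sphere 0 1) p" "integrable circ k"
  shows "integrable circ (\<lambda>z. p z * k z)"
proof -
  have [measurable]: "p \<in> borel_measurable circ" "k \<in> borel_measurable circ"
    using assms by (auto intro: borel_measurable_circ_continuous_on)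
  have "bounded (p ` sphere 0 1)"
    using assms(1) by (intro compact_imp_bounded compact_continuous_image) auto
  then obtain B where B: "\<And>z. cmod z = 1 \<Longrightarrow> cmod (p z) \<le> B"
    by (auto simp: bounded_iff) (metis mem_sphere_0)
  have "integrable circ (\<lambda>z. of_real B * k z)"
    using assms(2) by simp
  then show ?thesis
  proof (rule Bochner_Integration.integrable_bound)
    show "AE z in circ. norm (p z * k z) \<le> norm (of_real B * k z)"
      using AE_circ_sphere
      by eventually_elim (auto simp: norm_mult intro!: mult_right_mono dest!: B)
  qed simp
qed

lemma continuous_on_sphere_powi: "continuous_on (sphere 0 1) (\<lambda>z::complex. z powi n)"
  by (intro continuous_intros) auto

lemma integrable_circ_powi_mult:
  "integrable circ k \<Longrightarrow> integrable circ (\<lambda>z. z powi n * k z)"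
  by (rule integrable_circ_mult_continuous_on[OF continuous_on_sphere_powi])

section \<open>Functions whose Fourier coefficients all vanish\<close>

text \<open>As \<open>n\<close> runs over all integers, the characters need no conjugate: the
  integral is the Fourier coefficient of index \<open>- n\<close>.\<close>

definition fourier_null :: "(complex \<Rightarrow> complex) \<Rightarrow> bool" where
  "fourier_null k \<longleftrightarrow> integrable circ k \<and> (\<forall>n. (LINT z|circ. z powi n * k z) = 0)"

lemma fourier_null_cong:
  assumes "fourier_null k" "\<And>z. cmod z = 1 \<Longrightarrow> k z = k' z"
  shows "fourier_null k'"
proof -
  have "integrable circ k'"
    using assms unfolding fourier_null_def
    by (subst Bochner_Integration.integrable_cong[of _ circ _ k]) auto
  moreover have "(LINT z|circ. z powi n * k' z) = (LINT z|circ. z powi n * k z)" for n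
    using assms(2) by (intro Bochner_Integration.integral_cong) auto
  ultimately show ?thesis
    using assms(1) by (simp add: fourier_null_def)
qed

lemma fourier_null_add:
  assumes "fourier_null k" "fourier_null k'"
  shows "fourier_null (\<lambda>z. k z + k' z)"
  using assms by (simp add: fourier_null_def distrib_left integrable_circ_powi_mult)

lemma fourier_null_scale:
  assumes "fourier_null k"
  shows "fourier_null (\<lambda>z. c * k z)"
  using assms by (simp add: fourier_null_def mult.left_commute[of _ c])

lemma fourier_null_powi_mult:
  assumes "fourier_null k"
  shows "fourier_null (\<lambda>z. z powi m * k z)"
proof -
  have "z powi n * (z powi m * k z) = z powi (n + m) * k z" if "cmod z = 1" for n z
    using that by (subst power_int_add) auto
  then have "(LINT z|circ. z powi n * (z powi m * k z)) = (LINT z|circ. z powi (n + m) * k z)" for n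
    by (intro Bochner_Integration.integral_cong) auto
  with assms show ?thesis
    by (simp add: fourier_null_def integrable_circ_powi_mult)
qed

text \<open>Only the linear case has content: a real linear form restricted to the circle is a
  trigonometric polynomial of degree one. Concluding \<open>fourier_null\<close> again, for
  arbitrary \<open>k\<close>, lets the product case apply one factor after the other.\<close>

lemma fourier_null_mult_polynomial:
  assumes "real_polynomial_function p" "fourier_null k"
  shows "fourier_null (\<lambda>z. of_real (p z) * k z)"
  using assms
proof (induction arbitrary: k rule: real_polynomial_function.induct)
  case (linear f)
  \<comment> \<open>Substitute \<open>Re z = (z + 1/z) / 2\<close> and
    \<open>Im z = (z - 1/z) / (2 * \<i>)\<close> into \<open>Re z * f 1 + Im z * f \<i>\<close>;
    \<open>a\<close> is the coefficient of \<open>z\<close>.\<close>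
  define a where "a = (of_real (f 1) - \<i> * of_real (f \<i>)) / 2"
  have f: "of_real (f z) = a * z powi 1 + cnj a * z powi (-1)" if "cmod z = 1" for z
  proof -
    interpret bounded_linear f by fact
    have "f z = f (Re z *\<^sub>R 1 + Im z *\<^sub>R \<i>)"
      by (rule arg_cong[of _ _ f]) (simp add: complex_eq_iff)
    then have "f z = Re z * f 1 + Im z * f \<i>"
      by (simp add: add scaleR)
    moreover have "inverse z = cnj z"
      using that by (simp add: inverse_complex_def Complex_eq complex_eq_iff cmod_def)
    ultimately show ?thesis
      by (simp add: a_def power_int_minus complex_eq_iff diff_divide_distrib)
  qed
  have "fourier_null (\<lambda>z. a * (z powi 1 * k z) + cnj a * (z powi (-1) * k z))"
    using linear by (intro fourier_null_add fourier_null_scale fourier_null_powi_mult)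
  then show ?case
    by (rule fourier_null_cong) (simp only: f distrib_right mult.assoc)
next
  case (const c)
  then show ?case by (rule fourier_null_scale)
next
  case (add f g)
  then show ?case by (simp add: distrib_right fourier_null_add)
next
  case (mult f g)
  then show ?case by (simp add: mult.assoc)
qed

section \<open>From polynomials to continuous functions, closed sets and Borel sets\<close>

text \<open>By Stone-Weierstrass \<open>g\<close> is within \<open>e\<close> of a real polynomial on
  the circle, and the polynomial contributes nothing; the error is at most \<open>e\<close> times
  the L1 norm of \<open>k\<close>.\<close>

lemma fourier_null_integral_continuous:
  fixes g :: "complex \<Rightarrow> real"
  assumes k: "fourier_null k" and g: "continuous_on (sphere 0 1) g"
  shows "(LINT z|circ. of_real (g z) * k z) = 0"
proof -
  have ik: "integrable circ k"
    using k by (simp add: fourier_null_def)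
  define I where "I = (LINT z|circ. cmod (k z))"
  have I0: "I \<ge> 0"
    by (simp add: I_def)
  have le: "cmod (LINT z|circ. of_real (g z) * k z) \<le> e * I" if e: "e > 0" for e
  proof -
    obtain p where p: "real_polynomial_function p" "\<And>z. cmod z = 1 \<Longrightarrow> \<bar>g z - p z\<bar> < e"
      using Stone_Weierstrass_real_polynomial_function[OF compact_sphere g e] by (metis mem_sphere_0)
    have cp: "continuous_on (sphere 0 1) p"
      using p(1) continuous_on_polymonial_function real_polynomial_function_eq by blast
    have "(LINT z|circ. z powi 0 * (of_real (p z) * k z)) = 0"
      using fourier_null_mult_polynomial[OF p(1) k] unfolding fourier_null_def by blast
    then have "(LINT z|circ. of_real (g z) * k z)
        = (LINT z|circ. of_real (g z) * k z) - (LINT z|circ. of_real (p z) * k z)"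
      by simp
    also have "\<dots> = (LINT z|circ. of_real (g z) * k z - of_real (p z) * k z)"
      by (intro Bochner_Integration.integral_diff[symmetric] integrable_circ_mult_continuous_on
          continuous_intros g cp ik)
    also have "cmod \<dots> \<le> (LINT z|circ. e * cmod (k z))"
    proof (rule Bochner_Integration.integral_norm_bound_integral)
      show "integrable circ (\<lambda>z. of_real (g z) * k z - of_real (p z) * k z)"
        by (intro Bochner_Integration.integrable_diff integrable_circ_mult_continuous_on
            continuous_intros g cp ik)
      show "cmod (of_real (g z) * k z - of_real (p z) * k z) \<le> e * cmod (k z)"
        if "z \<in> space circ" for z
        using p(2)[of z] that
        by (auto simp: norm_mult simp flip: left_diff_distrib of_real_diff intro!: mult_right_mono)
    qed (use ik in simp)
    finally show ?thesis by (simp add: I_def)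
  qed
  have "cmod (LINT z|circ. of_real (g z) * k z) \<le> 0"
  proof (rule field_le_epsilon)
    fix e :: real assume "e > 0"
    \<comment> \<open>Dividing by \<open>I + 1\<close> instead of \<open>I\<close> covers the case
      \<open>I = 0\<close>.\<close>
    have "e / (I + 1) * I \<le> e"
      using \<open>e > 0\<close> I0 by (simp add: field_simps)
    with le[of "e / (I + 1)"] \<open>e > 0\<close> I0
    show "cmod (LINT z|circ. of_real (g z) * k z) \<le> 0 + e" by simp
  qed
  then show ?thesis by simp
qed

lemma borel_measurable_circ_indicator [measurable]: "A \<in> sets borel \<Longrightarrow> indicator A \<in> borel_measurable circ"
  for A :: "complex set"
  by (simp add: measurable_cong_sets[OF sets_circ refl] measurable_restrict_space1)

text \<open>The indicator of a nonempty closed set is the pointwise limit of continuous bumps with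
  values between 0 and 1, so dominated convergence with bound \<open>cmod (k z)\<close>
  applies.\<close>

lemma fourier_null_integral_closed:
  fixes F :: "complex set"
  assumes k: "fourier_null k" and F: "closed F"
  shows "(LINT z|circ. indicator F z *\<^sub>R k z) = 0"
\<comment> \<open>\<open>infdist\<close> to the empty set is 0 by convention, so the bumps would be
  constantly 1 there.\<close>
proof (cases "F = {}")
  case False
  have ik: "integrable circ k"
    using k by (simp add: fourier_null_def)
  note [measurable] = borel_measurable_integrable[OF ik]
  define g where "g n z = max 0 (1 - real n * infdist z F)" for n z
  have cg: "continuous_on (sphere 0 1) (g n)" for n
    unfolding g_def by (intro continuous_intros)
  have "(\<lambda>n. LINT z|circ. of_real (g n z) * k z) \<longlonglongrightarrow> (LINT z|circ. indicator F z *\<^sub>R k z)"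
  proof (rule integral_dominated_convergence[where w = "\<lambda>z. cmod (k z)"])
    show "(\<lambda>z. of_real (g n z) * k z) \<in> borel_measurable circ" for n
      using integrable_circ_mult_continuous_on[OF continuous_on_of_real[OF cg] ik, of n]
      by (rule borel_measurable_integrable)
    show "(\<lambda>z. indicator F z *\<^sub>R k z) \<in> borel_measurable circ"
      using F by measurable
    show "integrable circ (\<lambda>z. cmod (k z))"
      using ik by simp
    have "(\<lambda>n. g n z) \<longlonglongrightarrow> indicator F z" for z
    proof (cases "z \<in> F")
      case True
      then show ?thesis by (simp add: g_def)
    next
      case z: False
      then have d: "infdist z F > 0"
        using F False infdist_pos_not_in_closed by blast
      obtain N where N: "1 < real N * infdist z F"
        using ex_less_of_nat_mult[OF d] by blast
      have "g n z = 0" if "n \<ge> N" for n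
      proof -
        have "real N * infdist z F \<le> real n * infdist z F"
          using that d by (intro mult_right_mono) auto
        with N show ?thesis by (simp add: g_def)
      qed
      then have "(\<lambda>n. g n z) \<longlonglongrightarrow> 0"
        by (intro tendsto_eventually eventually_sequentiallyI)
      with z show ?thesis by simp
    qed
    then have "(\<lambda>n. of_real (g n z) * k z) \<longlonglongrightarrow> indicator F z *\<^sub>R k z" for z
      by (auto simp: scaleR_conv_of_real intro!: tendsto_intros)
    then show "AE z in circ. (\<lambda>n. of_real (g n z) * k z) \<longlonglongrightarrow> indicator F z *\<^sub>R k z"
      by simp
    show "AE z in circ. cmod (of_real (g n z) * k z) \<le> cmod (k z)" for n
      by (rule AE_I2) (auto simp: norm_mult g_def infdist_nonneg intro!: mult_left_le_one_le)
  qed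
  then have "(\<lambda>n. 0) \<longlonglongrightarrow> (LINT z|circ. indicator F z *\<^sub>R k z)"
    by (simp only: fourier_null_integral_continuous[OF k cg])
  then show ?thesis
    by (metis LIMSEQ_const_iff)
qed simp

text \<open>Dynkin's argument: closed sets form an intersection-stable generator, and the sets with
  vanishing integral are closed under complements and countable disjoint unions.\<close>

lemma fourier_null_integral_borel:
  fixes A :: "complex set"
  assumes k: "fourier_null k" and A: "A \<in> sets borel"
  shows "(LINT z|circ. indicator A z *\<^sub>R k z) = 0"
proof -
  have ik: "integrable circ k"
    using k by (simp add: fourier_null_def)
  note [measurable] = borel_measurable_integrable[OF ik]
  have ind: "integrable circ (\<lambda>z. indicator A z *\<^sub>R k z)" if "A \<in> sets borel" for A :: "complex set"
    using that by (intro Bochner_Integration.integrable_bound[OF ik] AE_I2)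
      (auto split: split_indicator)
  have "Int_stable (Collect closed :: complex set set)"
    by (auto simp: Int_stable_def)
  moreover have "Collect closed \<subseteq> Pow (UNIV :: complex set)" by simp
  moreover have "A \<in> sigma_sets UNIV (Collect closed)"
    using A by (simp add: borel_eq_closed)
  ultimately show ?thesis
  proof (induction rule: sigma_sets_induct_disjoint)
    case (basic A)
    then show ?case using fourier_null_integral_closed[OF k] by simp
  next
    case empty
    then show ?case by simp
  next
    case (compl A)
    then have "A \<in> sets borel" by (simp add: borel_eq_closed)
    have "(LINT z|circ. indicator (UNIV - A) z *\<^sub>R k z)
        = (LINT z|circ. indicator UNIV z *\<^sub>R k z - indicator A z *\<^sub>R k z)"
      by (intro Bochner_Integration.integral_cong) (auto simp: indicator_def)
    also have "\<dots> = (LINT z|circ. indicator UNIV z *\<^sub>R k z) - (LINT z|circ. indicator A z *\<^sub>R k z)"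
      using \<open>A \<in> sets borel\<close> by (intro Bochner_Integration.integral_diff ind) auto
    finally show ?case
      using compl fourier_null_integral_closed[OF k closed_UNIV] by simp
  next
    case (union A)
    then have A: "A i \<in> sets borel" for i by (auto simp: borel_eq_closed)
    have "(\<lambda>n. LINT z|circ. indicator (\<Union>i<n. A i) z *\<^sub>R k z)
        \<longlonglongrightarrow> (LINT z|circ. indicator (\<Union>i. A i) z *\<^sub>R k z)"
    proof (rule integral_dominated_convergence[where w = "\<lambda>z. cmod (k z)"])
      show "AE z in circ. (\<lambda>n. indicator (\<Union>i<n. A i) z *\<^sub>R k z) \<longlonglongrightarrow> indicator (\<Union>i. A i) z *\<^sub>R k z"
        by (intro AE_I2 tendsto_scaleR LIMSEQ_indicator_UN tendsto_const)
      show "AE z in circ. cmod (indicator (\<Union>i<n. A i) z *\<^sub>R k z) \<le> cmod (k z)" for n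
        by (rule AE_I2) (auto split: split_indicator)
      show "integrable circ (\<lambda>z. cmod (k z))"
        using ik by simp
    qed (use A in measurable)
    moreover have "(LINT z|circ. indicator (\<Union>i<n. A i) z *\<^sub>R k z) = 0" for n
    proof -
      have "(LINT z|circ. indicator (\<Union>i<n. A i) z *\<^sub>R k z)
          = (LINT z|circ. (\<Sum>i<n. indicator (A i) z *\<^sub>R k z))"
        using union(1)
        by (subst indicator_UN_disjoint)
           (auto simp: scaleR_sum_left intro: disjoint_family_on_mono)
      also have "\<dots> = (\<Sum>i<n. LINT z|circ. indicator (A i) z *\<^sub>R k z)"
        by (intro Bochner_Integration.integral_sum ind A)
      also have "\<dots> = 0"
        by (simp only: union sum.neutral_const)
      finally show ?thesis .
    qed
    ultimately have "(\<lambda>n. 0) \<longlonglongrightarrow> (LINT z|circ. indicator (\<Union>i. A i) z *\<^sub>R k z)" by simp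
    then show ?case by (metis LIMSEQ_const_iff)
  qed
qed

lemma fourier_null_AE_zero:
  assumes k: "fourier_null k"
  shows "AE z in circ. k z = 0"
proof (rule circ.density_zero)
  show "integrable circ k"
    using k by (simp add: fourier_null_def)
  fix A assume "A \<in> sets circ"
  \<comment> \<open>Measurable sets of \<open>circ\<close> are traces of Borel sets; the sphere is
    closed, so they are Borel in the plane.\<close>
  then obtain B where "B \<in> sets borel" and A: "A = B \<inter> sphere 0 1"
    by (auto simp: sets_circ sets_restrict_space)
  then have "A \<in> sets borel" by simp
  with fourier_null_integral_borel[OF k] show "set_lebesgue_integral circ A k = 0"
    by (simp add: set_lebesgue_integral_def)
qed

section \<open>Reflection and the Fourier coefficients of even parts\<close>

lemma integral_circ_uminus:
  fixes h :: "complex \<Rightarrow> complex"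
  assumes "h \<in> borel_measurable circ"
  shows "(LINT z|circ. h (- z)) = (LINT z|circ. h z)"
  using integral_distr[OF uminus_measurable_circ assms] by (simp add: circ_uminus_invariant)

lemma integrable_circ_uminus:
  fixes h :: "complex \<Rightarrow> complex"
  assumes "integrable circ h"
  shows "integrable circ (\<lambda>z. h (- z))"
  using integrable_distr[OF uminus_measurable_circ, of h] assms
  by (simp add: circ_uminus_invariant)

lemma even_part_eq_iff: "even_part f z = even_part g w \<longleftrightarrow> f z + f (- z) = g w + g (- w)"
  by (simp only: even_part_def divide_cancel_right) simp

text \<open>Substituting \<open>- z\<close> for \<open>z\<close> turns the coefficient of
  \<open>h (- z)\<close> at \<open>n\<close> into \<open>(-1)^n\<close> times that of
  \<open>h\<close>. The two halves therefore cancel for odd \<open>n\<close>, and for even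
  \<open>n\<close> both vanish by hypothesis.\<close>

lemma even_part_AE_zero:
  assumes h: "integrable circ h" and 0: "\<And>n. (LINT z|circ. z powi (2 * n) * h z) = 0"
  shows "AE z in circ. even_part h z = 0"
proof (rule fourier_null_AE_zero)
  have h': "integrable circ (\<lambda>z. h (- z))"
    by (rule integrable_circ_uminus[OF h])
  have "(LINT z|circ. z powi n * even_part h z) = 0" for n
  proof -
    have m: "(\<lambda>z. (- z) powi n * h z) \<in> borel_measurable circ"
      by (intro borel_measurable_integrable integrable_circ_mult_continuous_on h
          continuous_intros) auto
    have "(LINT z|circ. z powi n * even_part h z)
        = (LINT z|circ. (z powi n * h z + z powi n * h (- z)) / 2)"
      by (simp add: even_part_def distrib_left)
    also have "\<dots> = ((LINT z|circ. z powi n * h z) + (LINT z|circ. z powi n * h (- z))) / 2"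
      using h h' by (simp add: integrable_circ_powi_mult)
    also have "(LINT z|circ. z powi n * h (- z)) = (LINT z|circ. (- z) powi n * h z)"
      using integral_circ_uminus[OF m] by simp
    also have "((LINT z|circ. z powi n * h z) + \<dots>) / 2 = 0"
    proof (cases "even n")
      case True
      with 0[of "n div 2"] show ?thesis by (simp add: power_int_minus_left)
    next
      case False
      then show ?thesis by (simp add: power_int_minus_left)
    qed
    finally show ?thesis .
  qed
  moreover have "integrable circ (even_part h)"
    unfolding even_part_def[abs_def] using h h' by simp
  ultimately show "fourier_null (even_part h)"
    by (simp add: fourier_null_def)
qed

section \<open>Operators in terms of representatives\<close>

lemma L2rel_rep: "L2rel (rep_L2T f) (rep_L2T f)"
  using Quotient3_rep_reflp[OF Quotient3_L2T] .

lemma rep_sq_integrable: "rep_L2T f \<in> sq_integrable"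
  using L2rel_rep[of f] by (simp add: L2rel_def)

lemma rep_measurable [measurable]: "rep_L2T f \<in> borel_measurable circ"
  using rep_sq_integrable[of f] by (simp add: sq_integrable_def)

lemma abs_rep [simp]: "abs_L2T (rep_L2T f) = f"
  by (rule Quotient3_abs_rep[OF Quotient3_L2T])

text \<open>Together with the \<open>AE_rep\<close> lemmas this turns operator identities into
  pointwise identities almost everywhere.\<close>

lemma L2T_eq_iff_AE: "f = g \<longleftrightarrow> (AE z in circ. rep_L2T f z = rep_L2T g z)"
  using Quotient3_rel_rep[OF Quotient3_L2T, of f g] rep_sq_integrable
  by (auto simp: L2rel_def)

lemma AE_rep_abs: "\<phi> \<in> sq_integrable \<Longrightarrow> AE z in circ. rep_L2T (abs_L2T \<phi>) z = \<phi> z"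
  using rep_abs_rsp_left[OF Quotient3_L2T, of \<phi> \<phi>] by (simp add: L2rel_def)

lemma AE_rep_plus: "AE z in circ. rep_L2T (f + g) z = rep_L2T f z + rep_L2T g z"
  using AE_rep_abs[OF sq_integrable_add[OF rep_sq_integrable[of f] rep_sq_integrable[of g]]]
    plus_L2T.abs_eq[OF L2rel_rep[of f] L2rel_rep[of g]] by simp

lemma AE_rep_mult_op:
  "\<phi> \<in> Linfty \<Longrightarrow> AE z in circ. rep_L2T (mult_op \<phi> f) z = \<phi> z * rep_L2T f z"
  using AE_rep_abs[OF Linfty_mult_sq_integrable[OF _ rep_sq_integrable[of f]]]
    mult_op.abs_eq[OF L2rel_rep[of f], of \<phi>] by simp

lemma AE_rep_even: "AE z in circ. rep_L2T (even_L2T f) z = even_part (rep_L2T f) z"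
  using AE_rep_abs[OF sq_integrable_even_part[OF rep_sq_integrable[of f]]]
    even_L2T.abs_eq[OF L2rel_rep[of f]] by simp

lemma AE_rep_odd: "AE z in circ. rep_L2T (odd_L2T f) z = odd_part (rep_L2T f) z"
  using AE_rep_abs[OF sq_integrable_odd_part[OF rep_sq_integrable[of f]]]
    odd_L2T.abs_eq[OF L2rel_rep[of f]] by simp

lemma AE_rep_J: "AE z in circ. rep_L2T (J f) z = cnj (rep_L2T f z)"
  using AE_rep_abs[OF sq_integrable_cnj[OF rep_sq_integrable[of f]]]
    J.abs_eq[OF L2rel_rep[of f]] by simp

lemma inner_L2T_rep: "inner_L2T f g = (LINT z|circ. rep_L2T f z * cnj (rep_L2T g z))"
  using inner_L2T.abs_eq[OF L2rel_rep[of f] L2rel_rep[of g]] by simp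

lemma AE_rep_mult_op2_J:
  assumes "\<phi>\<^sub>1 \<in> Linfty" "\<phi>\<^sub>2 \<in> Linfty"
  shows "AE z in circ. rep_L2T (mult_op2 \<phi>\<^sub>1 \<phi>\<^sub>2 (J f)) z
    = \<phi>\<^sub>1 z * cnj (even_part (rep_L2T f) z) + \<phi>\<^sub>2 z * cnj (odd_part (rep_L2T f) z)"
  using AE_rep_plus[of "mult_op \<phi>\<^sub>1 (even_L2T (J f))" "mult_op \<phi>\<^sub>2 (odd_L2T (J f))"]
    AE_rep_mult_op[OF assms(1), of "even_L2T (J f)"] AE_rep_even[of "J f"]
    AE_rep_mult_op[OF assms(2), of "odd_L2T (J f)"] AE_rep_odd[of "J f"]
    AE_rep_J[of f] AE_circ_uminus[OF AE_rep_J[of f]]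
  by eventually_elim (simp add: mult_op2_def even_part_def odd_part_def)

text \<open>The product symbol is compared only on the circle, so that identities such as
  \<open>cnj z = inverse z\<close> may enter.\<close>

lemma mult_op_mult_op:
  assumes "\<phi> \<in> Linfty" "\<theta> \<in> Linfty" "\<xi> \<in> Linfty" "\<And>z. cmod z = 1 \<Longrightarrow> \<xi> z = \<phi> z * \<theta> z"
  shows "mult_op \<phi> (mult_op \<theta> f) = mult_op \<xi> f"
  unfolding L2T_eq_iff_AE
  using AE_rep_mult_op[OF assms(1), of "mult_op \<theta> f"] AE_rep_mult_op[OF assms(2), of f]
    AE_rep_mult_op[OF assms(3), of f] AE_circ_sphere
  by eventually_elim (simp add: assms(4))

lemma Linfty_continuous_on:
  assumes "continuous_on (sphere 0 1) p" "\<And>z. cmod z = 1 \<Longrightarrow> cmod (p z) \<le> B"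
  shows "p \<in> Linfty"
  using assms borel_measurable_circ_continuous_on[of p]
  by (auto simp: Linfty_def intro!: exI[of _ B] AE_I2)

lemma Linfty_powi: "(\<lambda>z. z powi n) \<in> Linfty"
  by (rule Linfty_continuous_on[OF continuous_on_sphere_powi, of _ 1]) (simp add: norm_power_int)

lemma Linfty_cnj: "cnj \<in> Linfty"
  by (rule Linfty_continuous_on[of _ 1]) (auto intro: continuous_intros)

lemma cnj_eq_inverse: "cmod z = 1 \<Longrightarrow> cnj z = inverse z"
  by (simp add: complex_eq_iff cmod_def)

lemma cnj_powi: "cmod z = 1 \<Longrightarrow> cnj (z powi n) = z powi (- n)"
  by (simp add: cnj_eq_inverse power_int_minus power_int_inverse)

section \<open>Inner products against powers, and their localization\<close>

lemma inner_mult_op_powi_left: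
  "inner_L2T (mult_op (\<lambda>z. z powi n) f) g
    = (LINT z|circ. z powi n * (rep_L2T f z * cnj (rep_L2T g z)))"
  unfolding inner_L2T_rep
proof (rule integral_cong_AE)
  have [measurable]: "(\<lambda>z. z powi n) \<in> borel_measurable circ"
    using Linfty_powi[of n] by (simp add: Linfty_def)
  show "(\<lambda>z. z powi n * (rep_L2T f z * cnj (rep_L2T g z))) \<in> borel_measurable circ"
    by measurable
  show "AE z in circ. rep_L2T (mult_op (\<lambda>z. z powi n) f) z * cnj (rep_L2T g z) =
      z powi n * (rep_L2T f z * cnj (rep_L2T g z))"
    using AE_rep_mult_op[OF Linfty_powi, of n f] by eventually_elim simp
qed measurable

lemma inner_mult_op_powi_right:
  "inner_L2T f (mult_op (\<lambda>z. z powi (- n)) g) = inner_L2T (mult_op (\<lambda>z. z powi n) f) g"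
  unfolding inner_L2T_rep
proof (rule integral_cong_AE)
  show "AE z in circ. rep_L2T f z * cnj (rep_L2T (mult_op (\<lambda>z. z powi (- n)) g) z) =
      rep_L2T (mult_op (\<lambda>z. z powi n) f) z * cnj (rep_L2T g z)"
    using AE_rep_mult_op[OF Linfty_powi, of n f] AE_rep_mult_op[OF Linfty_powi, of "- n" g]
      AE_circ_sphere
    by eventually_elim (simp add: cnj_powi del: complex_cnj_power_int)
qed measurable

lemma integrable_rep_mult_cnj: "integrable circ (\<lambda>z. rep_L2T f z * cnj (rep_L2T g z))"
proof (rule Bochner_Integration.integrable_bound)
  show "integrable circ (\<lambda>z. (cmod (rep_L2T f z))\<^sup>2 + (cmod (rep_L2T g z))\<^sup>2)"
    using rep_sq_integrable[of f] rep_sq_integrable[of g] by (simp add: sq_integrable_def)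
  have "x * y \<le> x\<^sup>2 + y\<^sup>2" if "x \<ge> 0" "y \<ge> 0" for x y :: real
    using sum_squares_bound[of x y] mult_nonneg_nonneg[OF that] by linarith
  then show "AE z in circ. cmod (rep_L2T f z * cnj (rep_L2T g z))
      \<le> norm ((cmod (rep_L2T f z))\<^sup>2 + (cmod (rep_L2T g z))\<^sup>2)"
    by (intro AE_I2) (simp add: norm_mult)
qed measurable

text \<open>The localization device: the difference of the two products is integrable and orthogonal
  to all even powers, so \<open>even_part_AE_zero\<close> applies to it.\<close>

lemma even_part_inner_eq:
  assumes "\<And>n. inner_L2T (mult_op (\<lambda>z. z powi (2 * n)) f) g
    = inner_L2T (mult_op (\<lambda>z. z powi (2 * n)) f') g'"
  shows "AE z in circ. even_part (\<lambda>z. rep_L2T f z * cnj (rep_L2T g z)) z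
    = even_part (\<lambda>z. rep_L2T f' z * cnj (rep_L2T g' z)) z"
proof -
  have "AE z in circ. even_part (\<lambda>z. rep_L2T f z * cnj (rep_L2T g z)
      - rep_L2T f' z * cnj (rep_L2T g' z)) z = 0"
  proof (rule even_part_AE_zero)
    fix n
    have "(LINT z|circ. z powi (2 * n) * (rep_L2T f z * cnj (rep_L2T g z)
          - rep_L2T f' z * cnj (rep_L2T g' z)))
        = (LINT z|circ. z powi (2 * n) * (rep_L2T f z * cnj (rep_L2T g z)))
          - (LINT z|circ. z powi (2 * n) * (rep_L2T f' z * cnj (rep_L2T g' z)))"
      unfolding right_diff_distrib
      by (intro Bochner_Integration.integral_diff integrable_circ_powi_mult integrable_rep_mult_cnj)
    also have "\<dots> = 0"
      using assms[of n] by (simp add: inner_mult_op_powi_left)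
    finally show "(LINT z|circ. z powi (2 * n) * (rep_L2T f z * cnj (rep_L2T g z)
          - rep_L2T f' z * cnj (rep_L2T g' z))) = 0" .
  qed (intro Bochner_Integration.integrable_diff integrable_rep_mult_cnj)
  then show ?thesis
    by eventually_elim (simp add: even_part_def flip: add_diff_add)
qed

section \<open>Conjugations intertwining multiplication by the square\<close>

text \<open>Nonnegative powers follow by iterating the relation; negative ones by applying it to
  \<open>C f\<close> and then applying \<open>C\<close> to both sides, as \<open>C\<close> is an
  involution.\<close>

lemma conjugation_mult_op_powi:
  assumes C: "conjugation C" and comm: "C \<circ> mult_op (\<lambda>z. z\<^sup>2) = mult_op (\<lambda>z. (cnj z)\<^sup>2) \<circ> C"
  shows "C (mult_op (\<lambda>z. z powi (2 * n)) f) = mult_op (\<lambda>z. z powi (- (2 * n))) (C f)"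
proof -
  have CC: "C (C f) = f" for f
    using C by (simp add: conjugation_def)
  have comm': "C (mult_op (\<lambda>z. z\<^sup>2) f) = mult_op (\<lambda>z. (cnj z)\<^sup>2) (C f)" for f
    using fun_cong[OF comm, of f] by simp
  have nat: "C (mult_op (\<lambda>z. z powi (2 * int m)) f) = mult_op (\<lambda>z. z powi (- (2 * int m))) (C f)"
    for m f
  proof (induction m)
    case 0
    have "mult_op (\<lambda>z. 1) f = f" for f
      unfolding L2T_eq_iff_AE using AE_rep_mult_op[OF Linfty_const, of 1 f] by simp
    then show ?case by simp
  next
    case (Suc m)
    have nz: "z \<noteq> 0" if "cmod z = 1" for z :: complex
      using that by auto
    have "mult_op (\<lambda>z. z\<^sup>2) (mult_op (\<lambda>z. z powi (2 * int m)) f)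
        = mult_op (\<lambda>z. z powi (2 * int (Suc m))) f"
      using nz by (intro mult_op_mult_op Linfty_powi Linfty_power2)
        (auto simp: power_int_add distrib_left)
    moreover have "mult_op (\<lambda>z. (cnj z)\<^sup>2) (mult_op (\<lambda>z. z powi (- (2 * int m))) (C f))
        = mult_op (\<lambda>z. z powi (- (2 * int (Suc m)))) (C f)"
      using nz by (intro mult_op_mult_op Linfty_powi Linfty_power2)
        (auto simp: power_int_diff power_int_minus distrib_left cnj_eq_inverse field_simps)
    ultimately show ?case
      using comm'[of "mult_op (\<lambda>z. z powi (2 * int m)) f"] Suc by simp
  qed
  show ?thesis
  proof (cases "n \<ge> 0")
    case True
    then show ?thesis using nat[of "nat n" f] by simp
  next
    case False
    with nat[of "nat (- n)" "C f"]
    have "C (mult_op (\<lambda>z. z powi (- (2 * n))) (C f)) = mult_op (\<lambda>z. z powi (2 * n)) f"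
      by (simp add: CC)
    then show ?thesis by (metis CC)
  qed
qed

lemma AE_conjugation_symmetric:
  assumes C: "conjugation C" and comm: "C \<circ> mult_op (\<lambda>z. z\<^sup>2) = mult_op (\<lambda>z. (cnj z)\<^sup>2) \<circ> C"
  shows "AE z in circ. even_part (\<lambda>z. rep_L2T (C f) z * cnj (rep_L2T g z)) z
    = even_part (\<lambda>z. rep_L2T (C g) z * cnj (rep_L2T f z)) z"
proof (rule even_part_inner_eq)
  fix n
  \<comment> \<open>Both arguments are written as values of \<open>C\<close>, with
    \<open>g = C (C g)\<close>, so that the conjugation property swaps them.\<close>
  have "inner_L2T (mult_op (\<lambda>z. z powi (2 * n)) (C f)) g
      = inner_L2T (C (mult_op (\<lambda>z. z powi (- (2 * n))) f)) (C (C g))"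
    using conjugation_mult_op_powi[OF C comm, of "- n" f] C by (simp add: conjugation_def)
  also have "\<dots> = inner_L2T (C g) (mult_op (\<lambda>z. z powi (- (2 * n))) f)"
    using C unfolding conjugation_def by blast
  also have "\<dots> = inner_L2T (mult_op (\<lambda>z. z powi (2 * n)) (C g)) f"
    by (rule inner_mult_op_powi_right)
  finally show "inner_L2T (mult_op (\<lambda>z. z powi (2 * n)) (C f)) g
      = inner_L2T (mult_op (\<lambda>z. z powi (2 * n)) (C g)) f" .
qed

lemma AE_conjugation_isometric:
  assumes C: "conjugation C" and comm: "C \<circ> mult_op (\<lambda>z. z\<^sup>2) = mult_op (\<lambda>z. (cnj z)\<^sup>2) \<circ> C"
  shows "AE z in circ. even_part (\<lambda>z. rep_L2T (C f) z * cnj (rep_L2T (C g) z)) z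
    = even_part (\<lambda>z. rep_L2T g z * cnj (rep_L2T f z)) z"
  using AE_conjugation_symmetric[OF C comm, of f "C g"] C by (simp add: conjugation_def)

section \<open>The converse direction\<close>

text \<open>Multiplication by the even function \<open>z\<^sup>2\<close> preserves parity, and
  \<open>J\<close> conjugates this factor.\<close>

lemma mult_op2_J_mult_op_square:
  assumes "\<psi>\<^sub>1 \<in> Linfty" "\<psi>\<^sub>2 \<in> Linfty"
  shows "mult_op2 \<psi>\<^sub>1 \<psi>\<^sub>2 (J (mult_op (\<lambda>z. z\<^sup>2) f)) = mult_op (\<lambda>z. (cnj z)\<^sup>2) (mult_op2 \<psi>\<^sub>1 \<psi>\<^sub>2 (J f))"
  unfolding L2T_eq_iff_AE
  using AE_rep_mult_op2_J[OF assms, of "mult_op (\<lambda>z. z\<^sup>2) f"] AE_rep_mult_op2_J[OF assms, of f]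
    AE_rep_mult_op[OF Linfty_power2(2), of "mult_op2 \<psi>\<^sub>1 \<psi>\<^sub>2 (J f)"]
    AE_rep_mult_op[OF Linfty_power2(1), of f]
    AE_circ_uminus[OF AE_rep_mult_op[OF Linfty_power2(1), of f]]
proof eventually_elim
  case (elim z)
  have "even_part (rep_L2T (mult_op (\<lambda>z. z\<^sup>2) f)) z = z\<^sup>2 * even_part (rep_L2T f) z"
    "odd_part (rep_L2T (mult_op (\<lambda>z. z\<^sup>2) f)) z = z\<^sup>2 * odd_part (rep_L2T f) z"
    using elim(4,5) by (simp_all add: even_part_def odd_part_def algebra_simps)
  with elim(1-3) show ?case
    by (simp add: algebra_simps)
qed

text \<open>The unprimed and primed numbers stand for the values at \<open>z\<close> and \<open>- z\<close>; up to the factor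
  \<open>1 / sqrt 2\<close> the matrix with rows \<open>(a, a')\<close> and \<open>(p, - p')\<close> is unitary, so its columns are
  normalized as well as its rows.\<close>

lemma column_norm_eq_2:
  fixes a a' p p' :: complex
  assumes "(cmod a)\<^sup>2 + (cmod a')\<^sup>2 = 2" "(cmod p)\<^sup>2 + (cmod p')\<^sup>2 = 2" "a * cnj p = a' * cnj p'"
  shows "(cmod a)\<^sup>2 + (cmod p)\<^sup>2 = 2"
proof -
  have "(cmod a)\<^sup>2 * (cmod p)\<^sup>2 = (cmod a')\<^sup>2 * (cmod p')\<^sup>2"
    using arg_cong[OF assms(3), of "\<lambda>w. (cmod w)\<^sup>2"] by (simp add: norm_mult power_mult_distrib)
  moreover have "(cmod a')\<^sup>2 = 2 - (cmod a)\<^sup>2" "(cmod p')\<^sup>2 = 2 - (cmod p)\<^sup>2"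
    using assms by simp_all
  ultimately show ?thesis by (simp add: algebra_simps)
qed

section \<open>Construction of the symbols\<close>

lemma commuting_conjugation_representation:
  assumes C: "conjugation C" and comm: "C \<circ> mult_op (\<lambda>z. z\<^sup>2) = mult_op (\<lambda>z. (cnj z)\<^sup>2) \<circ> C"
  shows "\<exists>\<psi>\<^sub>1\<in>Linfty. \<exists>\<psi>\<^sub>2\<in>Linfty.
    C = mult_op2 \<psi>\<^sub>1 \<psi>\<^sub>2 \<circ> J \<and>
    (AE z in circ. odd_part \<psi>\<^sub>1 z = odd_part \<psi>\<^sub>2 z) \<and>
    (AE z in circ. (cmod (\<psi>\<^sub>1 z))\<^sup>2 + (cmod (\<psi>\<^sub>2 z))\<^sup>2 = 2)"
proof -
  note sym = AE_conjugation_symmetric[OF C comm] and iso = AE_conjugation_isometric[OF C comm]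
  have sq: "(\<lambda>z. 1) \<in> sq_integrable" "cnj \<in> sq_integrable"
    using Linfty_mult_sq_integrable[OF Linfty_cnj, of "\<lambda>z. 1"]
    by (simp_all add: sq_integrable_def)
  define one where "one = abs_L2T (\<lambda>z. 1)"
  define zbar where "zbar = abs_L2T cnj"
  have one: "AE z in circ. rep_L2T one z = 1 \<and> rep_L2T one (- z) = 1"
    using AE_rep_abs[OF sq(1)] AE_circ_uminus[OF AE_rep_abs[OF sq(1)]]
    unfolding one_def by eventually_elim simp
  have zbar: "AE z in circ. rep_L2T zbar z = cnj z \<and> rep_L2T zbar (- z) = - cnj z"
    using AE_rep_abs[OF sq(2)] AE_circ_uminus[OF AE_rep_abs[OF sq(2)]]
    unfolding zbar_def by eventually_elim simp
  \<comment> \<open>These choices are forced: for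
    \<open>C = mult_op2 \<psi>\<^sub>1 \<psi>\<^sub>2 \<circ> J\<close> the even function 1 is sent
    to \<open>\<psi>\<^sub>1\<close>, and the odd function \<open>cnj\<close> to
    \<open>z * \<psi>\<^sub>2 z\<close>.\<close>
  define a where "a = rep_L2T (C one)"
  define p where "p z = cnj z * rep_L2T (C zbar) z" for z
  have Czbar: "rep_L2T (C zbar) z = z * p z" "rep_L2T (C zbar) (- z) = - z * p (- z)"
    if "cmod z = 1" for z
  proof -
    have "z * cnj z = 1"
      using that by (simp add: complex_norm_square[symmetric])
    then show "rep_L2T (C zbar) z = z * p z" "rep_L2T (C zbar) (- z) = - z * p (- z)"
      by (simp_all add: p_def mult.assoc[symmetric])
  qed
  have [measurable]: "cnj \<in> borel_measurable circ"
    using Linfty_cnj by (simp add: Linfty_def)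
  have [measurable]: "a \<in> borel_measurable circ" "p \<in> borel_measurable circ"
    unfolding a_def p_def[abs_def] by measurable
  have row_a: "AE z in circ. (cmod (a z))\<^sup>2 + (cmod (a (- z)))\<^sup>2 = 2"
    using iso[of one one] one
  proof eventually_elim
    case (elim z)
    then have "a z * cnj (a z) + a (- z) * cnj (a (- z)) = 2"
      by (simp add: even_part_def a_def)
    then have "complex_of_real ((cmod (a z))\<^sup>2 + (cmod (a (- z)))\<^sup>2) = of_real 2"
      by (simp only: of_real_add complex_norm_square) simp
    then show ?case by (simp only: of_real_eq_iff)
  qed
  have row_p: "AE z in circ. (cmod (p z))\<^sup>2 + (cmod (p (- z)))\<^sup>2 = 2"
    using iso[of zbar zbar] zbar AE_circ_sphere
  proof eventually_elim
    case (elim z)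
    then have zz: "z * cnj z = 1"
      by (simp add: complex_norm_square[symmetric])
    have "(z * cnj z) * (p z * cnj (p z) + p (- z) * cnj (p (- z))) = 2 * (z * cnj z)"
      using elim by (simp add: even_part_def Czbar field_simps)
    then have "complex_of_real ((cmod (p z))\<^sup>2 + (cmod (p (- z)))\<^sup>2) = of_real 2"
      by (simp only: of_real_add complex_norm_square zz) simp
    then show ?case by (simp only: of_real_eq_iff)
  qed
  \<comment> \<open>The right side of the isometric identity is the even part of the odd function
    \<open>cnj\<close>, hence 0. The sign of \<open>z\<close> at \<open>- z\<close> turns the
    vanishing sum into an equality.\<close>
  have rows_orth: "AE z in circ. a z * cnj (p z) = a (- z) * cnj (p (- z))"
    using iso[of one zbar] one zbar AE_circ_sphere
  proof eventually_elim
    case (elim z)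
    then have "cnj z * (a z * cnj (p z)) = cnj z * (a (- z) * cnj (p (- z)))"
      by (simp add: even_part_def Czbar a_def field_simps)
    with elim show ?case by auto
  qed
  have odd: "AE z in circ. a z - a (- z) = p z - p (- z)"
    using sym[of one zbar] one zbar AE_circ_sphere
  proof eventually_elim
    case (elim z)
    then have "z * (a z - a (- z)) = z * (p z - p (- z))"
      by (simp add: even_part_eq_iff Czbar a_def algebra_simps)
    with elim show ?case by auto
  qed
  \<comment> \<open>Each summand is at most 2, so the row norms alone bound both symbols by
    \<open>sqrt 2\<close>.\<close>
  have bounded: "f \<in> Linfty"
    if "AE z in circ. (cmod (f z))\<^sup>2 + (cmod (f (- z)))\<^sup>2 = 2" "f \<in> borel_measurable circ" for f
  proof -
    have "AE z in circ. cmod (f z) \<le> sqrt 2"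
      using that(1)
    proof eventually_elim
      case (elim z)
      then show ?case
        using zero_le_power2[of "cmod (f (- z))"] by (intro real_le_rsqrt) linarith
    qed
    with that(2) show ?thesis by (auto simp: Linfty_def)
  qed
  have a: "a \<in> Linfty" and p: "p \<in> Linfty"
    using row_a row_p by (auto intro: bounded)
  have "C f = mult_op2 a p (J f)" for f
    unfolding L2T_eq_iff_AE
    using sym[of f one] sym[of f zbar] odd one zbar AE_rep_mult_op2_J[OF a p, of f] AE_circ_sphere
  proof eventually_elim
    case (elim z)
    define u u' w w' where "u = rep_L2T (C f) z" "u' = rep_L2T (C f) (- z)"
      "w = cnj (rep_L2T f z)" "w' = cnj (rep_L2T f (- z))"
    note u_def = this
    \<comment> \<open>Testing against 1 yields the even part of \<open>C f\<close>.\<close>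
    have 1: "u + u' = a z * w + a (- z) * w'"
      using elim(1,4) by (simp add: even_part_eq_iff a_def u_def)
    \<comment> \<open>Testing against \<open>cnj\<close> yields the odd part, up to the factor
      \<open>z\<close>.\<close>
    have "z * (u - u') = z * (p z * w - p (- z) * w')"
      using elim(2,5,7) by (simp add: even_part_eq_iff Czbar u_def algebra_simps)
    then have 2: "u - u' = p z * w - p (- z) * w'"
      using elim by auto
    have "2 * u = (u + u') + (u - u')" by simp
    also have "\<dots> = a z * w + p z * w + (a (- z) - p (- z)) * w'"
      unfolding 1 2 by (simp add: algebra_simps)
    \<comment> \<open>Equality of the odd parts removes the symbol values at \<open>- z\<close>,
      leaving coefficients at \<open>z\<close> as a multiplication operator requires.\<close>
    also have "a (- z) - p (- z) = a z - p z"
      using elim by (simp add: algebra_simps)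
    finally have "2 * u = a z * (w + w') + p z * (w - w')"
      by (simp add: algebra_simps)
    then have "u = (a z * (w + w') + p z * (w - w')) / 2"
      by (metis nonzero_mult_div_cancel_left zero_neq_numeral)
    then have "u = a z * ((w + w') / 2) + p z * ((w - w') / 2)"
      by (simp add: add_divide_distrib)
    with elim show ?case
      by (simp add: even_part_def odd_part_def u_def)
  qed
  then have "C = mult_op2 a p \<circ> J" by auto
  moreover have "AE z in circ. odd_part a z = odd_part p z"
    using odd by eventually_elim (simp add: odd_part_def)
  \<comment> \<open>The row relations pair values at \<open>z\<close> and \<open>- z\<close>;
    passing to columns gives a relation at the single point \<open>z\<close>.\<close>
  moreover have "AE z in circ. (cmod (a z))\<^sup>2 + (cmod (p z))\<^sup>2 = 2"
    using row_a row_p rows_orth by eventually_elim (rule column_norm_eq_2)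
  ultimately show ?thesis
    using a p by blast
qed

theorem corollary4p2:
  fixes C :: "L2T \<Rightarrow> L2T"
  assumes "conjugation C"
  shows "(C \<circ> mult_op (\<lambda>z. z\<^sup>2) = mult_op (\<lambda>z. (cnj z)\<^sup>2) \<circ> C \<longrightarrow>
            (\<exists>\<psi>\<^sub>1\<in>Linfty. \<exists>\<psi>\<^sub>2\<in>Linfty.
               C = mult_op2 \<psi>\<^sub>1 \<psi>\<^sub>2 \<circ> J \<and>
               (AE z in circ. odd_part \<psi>\<^sub>1 z = odd_part \<psi>\<^sub>2 z) \<and>
               (AE z in circ. (cmod (\<psi>\<^sub>1 z))\<^sup>2 + (cmod (\<psi>\<^sub>2 z))\<^sup>2 = 2))) \<and>
         (\<forall>\<psi>\<^sub>1\<in>Linfty. \<forall>\<psi>\<^sub>2\<in>Linfty.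
            C = mult_op2 \<psi>\<^sub>1 \<psi>\<^sub>2 \<circ> J \<longrightarrow>
            C \<circ> mult_op (\<lambda>z. z\<^sup>2) = mult_op (\<lambda>z. (cnj z)\<^sup>2) \<circ> C)"
  using commuting_conjugation_representation[OF assms]
  by (auto simp: fun_eq_iff mult_op2_J_mult_op_square)

end
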